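(* Let $X$ be a complex Hilbert space, and let $Y$ be a complex Banach space. Let $T \in \mathcal{L}(X)$ be power-bounded, and let $S \in \mathcal{L}(Y,X)$. Let $\alpha > 0$ and $k \in \mathbb{N}$ satisfy $k > \alpha + 1/2$. Then the following statements are equivalent: (i) $\|T^nS\| = O(n^{-\alpha})$ as $n \to \infty$. (ii) There exists a constant $M>0$ such that $$\sup_{1<r<2} (r-1)^{2k-2\alpha - 1}\int_{0}^{2\pi} \|R(r e^{i \theta}, T)^k S y\|^2 \, d\theta \leq M \|y\|^2$$ for all $y \in Y$.
   Context: $\mathcal{L}(Y,X)$ denotes the space of bounded linear operators from $Y$ to $X$, and $\mathcal{L}(X)=\mathcal{L}(X,X)$. An operator $T \in \mathcal{L}(X)$ is power-bounded if $\sup_{n \ge 0}\|T^n\| < \infty$ (then its spectral radius is at most $1$). For $\lambda$ in the resolvent set of $T$, $R(\lambda,T) = (\lambda I - T)^{-1}$. $\mathbb{N}$ is the set of positive integers. $a(n) = O(b(n))$ as $n\to\infty$ means there are constants $K>0$, $n_0$ with $a(n)\le K b(n)$ for all $n \ge n_0$. *)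

theory Defs
  imports "HOL-Analysis.Analysis"
begin

class complex_vector = real_vector +
  fixes scaleC :: "complex \<Rightarrow> 'a \<Rightarrow> 'a" (infixr "*\<^sub>C" 75)
  assumes scaleC_add_right: "a *\<^sub>C (x + y) = a *\<^sub>C x + a *\<^sub>C y"
    and scaleC_add_left: "(a + b) *\<^sub>C x = a *\<^sub>C x + b *\<^sub>C x"
    and scaleC_scaleC: "a *\<^sub>C b *\<^sub>C x = (a * b) *\<^sub>C x"
    and scaleC_one: "1 *\<^sub>C x = x"
    and scaleR_scaleC: "r *\<^sub>R x = complex_of_real r *\<^sub>C x"

class complex_normed_vector = complex_vector + real_normed_vector +
  assumes norm_scaleC: "norm (a *\<^sub>C x) = cmod a * norm x"

class complex_banach = complex_normed_vector + banach

text \<open>The inner product is linear in the first and conjugate-linear in the second argument.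
  Positive definiteness is part of the last axiom, since the norm is definite.\<close>

class complex_inner = complex_normed_vector +
  fixes cinner :: "'a \<Rightarrow> 'a \<Rightarrow> complex"
  assumes cinner_commute: "cinner x y = cnj (cinner y x)"
    and cinner_add_left: "cinner (x + y) z = cinner x z + cinner y z"
    and cinner_scaleC_left: "cinner (a *\<^sub>C x) y = a * cinner x y"
    and cinner_self: "cinner x x = complex_of_real ((norm x)\<^sup>2)"

class complex_hilbert = complex_inner + complex_banach

instantiation complex :: complex_hilbert
begin

definition scaleC_complex :: "complex \<Rightarrow> complex \<Rightarrow> complex" where
  "scaleC_complex a x = a * x"

definition cinner_complex :: "complex \<Rightarrow> complex \<Rightarrow> complex" where
  "cinner_complex x y = x * cnj y"

instance
proof
  fix a b x y z :: complex and r :: real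
  show "a *\<^sub>C (x + y) = a *\<^sub>C x + a *\<^sub>C y"
    by (simp add: scaleC_complex_def distrib_left)
  show "(a + b) *\<^sub>C x = a *\<^sub>C x + b *\<^sub>C x"
    by (simp add: scaleC_complex_def distrib_right)
  show "a *\<^sub>C b *\<^sub>C x = (a * b) *\<^sub>C x"
    by (simp add: scaleC_complex_def mult.assoc)
  show "1 *\<^sub>C x = x"
    by (simp add: scaleC_complex_def)
  show "r *\<^sub>R x = complex_of_real r *\<^sub>C x"
    by (simp add: scaleC_complex_def scaleR_conv_of_real)
  show "norm (a *\<^sub>C x) = cmod a * norm x"
    by (simp add: scaleC_complex_def norm_mult)
  show "cinner x y = cnj (cinner y x)"
    by (simp add: cinner_complex_def mult.commute)
  show "cinner (x + y) z = cinner x z + cinner y z"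
    by (simp add: cinner_complex_def distrib_right)
  show "cinner (a *\<^sub>C x) y = a * cinner x y"
    by (simp add: cinner_complex_def scaleC_complex_def mult.assoc)
  show "cinner x x = complex_of_real ((norm x)\<^sup>2)"
    unfolding cinner_complex_def by (rule complex_norm_square[symmetric])
qed

end

definition bounded_clinear :: "('a::complex_normed_vector \<Rightarrow> 'b::complex_normed_vector) \<Rightarrow> bool" where
  "bounded_clinear f \<longleftrightarrow> bounded_linear f \<and> (\<forall>c x. f (c *\<^sub>C x) = c *\<^sub>C f x)"

definition power_bounded :: "('a::complex_normed_vector \<Rightarrow> 'a) \<Rightarrow> bool" where
  "power_bounded T \<longleftrightarrow> bdd_above (range (\<lambda>n. onorm (T ^^ n)))"

text \<open>The resolvent is meaningful only for \<open>z\<close> in the resolvent set of \<open>T\<close>, that is, when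
  \<open>z I - T\<close> is bijective; for power-bounded \<open>T\<close> this includes all \<open>z\<close> with modulus
  greater than one.\<close>

definition resolvent :: "complex \<Rightarrow> ('a::complex_normed_vector \<Rightarrow> 'a) \<Rightarrow> 'a \<Rightarrow> 'a" where
  "resolvent z T = inv (\<lambda>x. z *\<^sub>C x - T x)"

end

theory Submission
  imports Defs
begin

text \<open>
  For \<open>|z| > 1\<close> the resolvent power expands as
  \<open>R(z,T)\<^sup>k = \<Sum>\<^sub>m c\<^sub>m z\<^bsup>-(m+k)\<^esup> T\<^sup>m\<close>, where \<open>c\<^sub>m\<close> is the \<open>m\<close>-th Taylor coefficient of
  \<open>(1 - q)\<^bsup>-k\<^esup>\<close> and grows like \<open>m\<^bsup>k-1\<^esup>\<close>. By Parseval's identity in the Hilbert space, the integral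
  in (ii) equals \<open>2\<pi> \<Sum>\<^sub>m c\<^sub>m\<^sup>2 r\<^bsup>-2(m+k)\<^esup> \<parallel>T\<^sup>m S y\<parallel>\<^sup>2\<close>. Under (i) this series is dominated by the
  binomial series of \<open>(1 - 1/r)\<^bsup>-\<gamma>\<^esup>\<close> with \<open>\<gamma> = 2k - 2\<alpha> - 1 > 0\<close>. Conversely, power-boundedness
  gives \<open>\<parallel>T\<^sup>N S y\<parallel> \<le> K \<parallel>T\<^sup>m S y\<parallel>\<close> for \<open>m \<le> N\<close>, so for \<open>r = 1 + 1/N\<close> the first \<open>N\<close> terms of the
  series already bound \<open>N\<^bsup>2k-1\<^esup> \<parallel>T\<^sup>N S y\<parallel>\<^sup>2\<close> by a multiple of \<open>N\<^sup>\<gamma> \<parallel>y\<parallel>\<^sup>2\<close>.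
\<close>

subsection \<open>Parseval's identity in a complex Hilbert space\<close>

lemma bounded_linear_scaleC: "bounded_linear (\<lambda>x::'a::complex_normed_vector. a *\<^sub>C x)"
proof (rule bounded_linear_intro[where K = "cmod a"])
  fix x y :: 'a and r :: real
  show "a *\<^sub>C (x + y) = a *\<^sub>C x + a *\<^sub>C y" by (rule scaleC_add_right)
  show "a *\<^sub>C (r *\<^sub>R x) = r *\<^sub>R (a *\<^sub>C x)"
    by (simp add: scaleR_scaleC scaleC_scaleC mult.commute)
  show "norm (a *\<^sub>C x) \<le> norm x * cmod a" by (simp add: norm_scaleC mult.commute)
qed

lemma scaleC_zero_left: "0 *\<^sub>C (x::'a::complex_normed_vector) = 0"
  by (metis mult_zero_left norm_eq_zero norm_scaleC norm_zero)

lemma scaleC_diff_left: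
  "(a - b) *\<^sub>C (x::'a::complex_normed_vector) = a *\<^sub>C x - b *\<^sub>C x"
  by (metis add_diff_cancel_right' diff_add_cancel scaleC_add_left)

lemma cinner_scaleC_right: "cinner x (a *\<^sub>C y) = cnj a * cinner x (y::'a::complex_inner)"
  by (metis cinner_commute cinner_scaleC_left complex_cnj_mult)

lemma cinner_sum_left:
  "cinner (\<Sum>i\<in>A. f i) (y::'a::complex_inner) = (\<Sum>i\<in>A. cinner (f i) y)"
proof (induction A rule: infinite_finite_induct)
  have "cinner 0 y = 0"
    using cinner_add_left[of 0 0 y] by simp
  then show "cinner (\<Sum>i\<in>{}. f i) y = (\<Sum>i\<in>{}. cinner (f i) y)"
    and "\<And>A. infinite A \<Longrightarrow> cinner (\<Sum>i\<in>A. f i) y = (\<Sum>i\<in>A. cinner (f i) y)"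
    by simp_all
qed (simp add: cinner_add_left)

lemma cinner_sum_right:
  "cinner (x::'a::complex_inner) (\<Sum>i\<in>A. f i) = (\<Sum>i\<in>A. cinner x (f i))"
  by (subst cinner_commute, subst cinner_sum_left, subst cnj_sum)
     (simp flip: cinner_commute)

text \<open>Orthogonality of characters: for \<open>j \<noteq> 0\<close> the antiderivative
  \<open>cis (j * \<theta>) / (\<i> * j)\<close> is periodic with period \<open>2 * pi\<close>, so
  its endpoint values cancel.\<close>

lemma has_integral_cis_multiple:
  "((\<lambda>\<theta>. cis (real_of_int j * \<theta>)) has_integral (if j = 0 then 2 * pi else 0)) {0..2 * pi}"
proof (cases "j = 0")
  case True
  with has_integral_const_real[of "1::complex" 0 "2 * pi"] show ?thesis
    by (simp add: scaleR_conv_of_real)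
next
  case False
  have "((\<lambda>\<theta>. cis (real_of_int j * \<theta>)) has_integral
     (cis (real_of_int j * (2 * pi)) / (\<i> * of_int j) - cis (real_of_int j * 0) / (\<i> * of_int j))) {0..2 * pi}"
  proof (rule fundamental_theorem_of_calculus)
    fix x :: real
    assume "x \<in> {0..2 * pi}"
    have "((\<lambda>z. exp (\<i> * of_int j * z) / (\<i> * of_int j)) has_field_derivative
        exp (\<i> * of_int j * of_real x)) (at (of_real x))"
      using False by (auto intro!: derivative_eq_intros)
    then have "((\<lambda>\<theta>. exp (\<i> * of_int j * of_real \<theta>) / (\<i> * of_int j)) has_vector_derivative
        exp (\<i> * of_int j * of_real x)) (at x within {0..2 * pi})"
      by (rule has_vector_derivative_real_field)
    then show "((\<lambda>\<theta>. cis (real_of_int j * \<theta>) / (\<i> * of_int j)) has_vector_derivative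
        cis (real_of_int j * x)) (at x within {0..2 * pi})"
      by (simp add: cis_conv_exp mult.assoc)
  qed simp
  moreover have "cis (real_of_int j * (2 * pi)) = 1"
    using cis_multiple_2pi[of "of_int j"] by (simp add: mult.commute)
  ultimately show ?thesis using False by simp
qed

text \<open>Expanding the square by sesquilinearity gives a finite trigonometric polynomial, which
  can be integrated term by term and is visibly continuous in \<open>\<theta>\<close>.\<close>

lemma norm_trig_sum_squared:
  fixes v :: "nat \<Rightarrow> 'a::complex_inner"
  shows "(norm (\<Sum>m<N. cis (- (real m * \<theta>)) *\<^sub>C v m))\<^sup>2
    = Re (\<Sum>m<N. \<Sum>l<N. cis (real_of_int (int l - int m) * \<theta>) * cinner (v m) (v l))"
proof -
  let ?s = "\<Sum>m<N. cis (- (real m * \<theta>)) *\<^sub>C v m"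
  have "(norm ?s)\<^sup>2 = Re (cinner ?s ?s)"
    by (simp add: cinner_self)
  also have "cinner ?s ?s = (\<Sum>m<N. \<Sum>l<N. cis (- (real m * \<theta>)) * (cis (real l * \<theta>) * cinner (v m) (v l)))"
    unfolding cinner_sum_left unfolding cinner_sum_right
    by (simp add: cinner_scaleC_left cinner_scaleC_right cis_cnj sum_distrib_left mult.left_commute)
  also have "\<dots> = (\<Sum>m<N. \<Sum>l<N. cis (real_of_int (int l - int m) * \<theta>) * cinner (v m) (v l))"
    by (simp add: cis_mult left_diff_distrib flip: mult.assoc)
  finally show ?thesis .
qed

lemma has_integral_norm_trig_sum_squared:
  fixes v :: "nat \<Rightarrow> 'a::complex_inner"
  shows "((\<lambda>\<theta>. (norm (\<Sum>m<N. cis (- (real m * \<theta>)) *\<^sub>C v m))\<^sup>2) has_integral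
    (\<Sum>m<N. 2 * pi * (norm (v m))\<^sup>2)) {0..2 * pi}"
proof -
  have "((\<lambda>\<theta>. \<Sum>m<N. \<Sum>l<N. cis (real_of_int (int l - int m) * \<theta>) * cinner (v m) (v l))
    has_integral (\<Sum>m<N. \<Sum>l<N. (if int l - int m = 0 then 2 * pi else 0) * cinner (v m) (v l))) {0..2 * pi}"
    by (intro has_integral_sum has_integral_mult_left has_integral_cis_multiple finite_lessThan)
  from has_integral_linear[OF this bounded_linear_Re]
  have "((\<lambda>\<theta>. (norm (\<Sum>m<N. cis (- (real m * \<theta>)) *\<^sub>C v m))\<^sup>2) has_integral
    Re (\<Sum>m<N. \<Sum>l<N. (if int l - int m = 0 then 2 * pi else 0) * cinner (v m) (v l))) {0..2 * pi}"
    unfolding norm_trig_sum_squared o_def .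
  \<comment> \<open>Only the diagonal survives the integration, where
    \<open>cinner (v m) (v m)\<close> is a squared norm.\<close>
  also have "(\<Sum>m<N. \<Sum>l<N. (if int l - int m = 0 then 2 * pi else 0) * cinner (v m) (v l))
    = (\<Sum>m<N. \<Sum>l<N. if m = l then 2 * pi * cinner (v m) (v l) else 0)"
    by (intro sum.cong refl) auto
  also have "\<dots> = complex_of_real (\<Sum>m<N. 2 * pi * (norm (v m))\<^sup>2)"
    by (simp add: cinner_self)
  finally show ?thesis by simp
qed

text \<open>Absolute summability bounds all partial sums uniformly in \<open>\<theta>\<close>, so
  dominated convergence carries the finite identity to the limit.\<close>

lemma parseval_nn_integral:
  fixes v :: "nat \<Rightarrow> 'a::complex_hilbert"
  assumes sv: "summable (\<lambda>m. norm (v m))"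
  obtains "summable (\<lambda>m. (norm (v m))\<^sup>2)"
    and "(\<integral>\<^sup>+ \<theta>\<in>{0..2 * pi}. ennreal ((norm (\<Sum>m. cis (- (real m * \<theta>)) *\<^sub>C v m))\<^sup>2) \<partial>lborel)
      = ennreal (2 * pi * (\<Sum>m. (norm (v m))\<^sup>2))"
proof -
  define f where "f N \<theta> = (norm (\<Sum>m<N. cis (- (real m * \<theta>)) *\<^sub>C v m))\<^sup>2" for N \<theta>
  define g where "g \<theta> = (norm (\<Sum>m. cis (- (real m * \<theta>)) *\<^sub>C v m))\<^sup>2" for \<theta>
  define B where "B = (\<Sum>m. norm (v m))"
  have lim: "(\<lambda>N. f N \<theta>) \<longlonglongrightarrow> g \<theta>" for \<theta>
  proof -
    have "summable (\<lambda>m. cis (- (real m * \<theta>)) *\<^sub>C v m)"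
      by (rule summable_norm_cancel) (use sv in \<open>simp add: norm_scaleC\<close>)
    then show ?thesis
      unfolding f_def g_def by (intro tendsto_power tendsto_norm summable_LIMSEQ)
  qed
  have hi: "(f N has_integral (\<Sum>m<N. 2 * pi * (norm (v m))\<^sup>2)) {0..2 * pi}" for N
    unfolding f_def by (rule has_integral_norm_trig_sum_squared)
  have bd: "norm (f N \<theta>) \<le> B\<^sup>2" for N \<theta>
  proof -
    have "norm (\<Sum>m<N. cis (- (real m * \<theta>)) *\<^sub>C v m) \<le> (\<Sum>m<N. norm (v m))"
      by (rule order.trans[OF norm_sum]) (simp add: norm_scaleC)
    also have "\<dots> \<le> B"
      unfolding B_def by (intro sum_le_suminf sv) auto
    finally show ?thesis by (simp add: f_def power_mono)
  qed
  have integrable_f: "f N integrable_on {0..2 * pi}" for N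
    using hi by (rule has_integral_integrable)
  have integrable_B: "(\<lambda>_. B\<^sup>2) integrable_on {0..2 * pi}"
    by (rule integrable_const_ivl)
  note * = dominated_convergence[OF integrable_f integrable_B bd lim]
  \<comment> \<open>The integrals of \<open>f N\<close> are the partial sums of the series of
    squares, so their convergence yields summability and the value of the sum at once.\<close>
  from *(2) have "(\<lambda>m. 2 * pi * (norm (v m))\<^sup>2) sums integral {0..2 * pi} g"
    using hi by (simp add: sums_def has_integral_iff)
  then have sums: "(\<lambda>m. (norm (v m))\<^sup>2) sums (integral {0..2 * pi} g / (2 * pi))"
    using sums_mult_iff[of "2 * pi" "\<lambda>m. (norm (v m))\<^sup>2" "integral {0..2 * pi} g / (2 * pi)"] by simp
  \<comment> \<open>The nonnegative Lebesgue integral needs Borel measurability: the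
    \<open>f N\<close> are continuous, and \<open>g\<close> is their pointwise limit.\<close>
  have fm: "f N \<in> borel_measurable borel" for N
    unfolding f_def norm_trig_sum_squared
    by (intro borel_measurable_continuous_onI continuous_intros)
  have gm: "g \<in> borel_measurable borel"
    by (rule borel_measurable_LIMSEQ_real[OF lim]) (use fm in auto)
  have "(\<integral>\<^sup>+ \<theta>\<in>{0..2 * pi}. ennreal (g \<theta>) \<partial>lborel)
    = (\<integral>\<^sup>+ \<theta>. ennreal (if \<theta> \<in> {0..2 * pi} then g \<theta> else 0) \<partial>lborel)"
    by (intro nn_integral_cong) (simp add: indicator_def)
  also have "\<dots> = ennreal (integral {0..2 * pi} g)"
  proof (rule nn_integral_has_integral_lborel)
    show "((\<lambda>\<theta>. if \<theta> \<in> {0..2 * pi} then g \<theta> else 0) has_integral integral {0..2 * pi} g) UNIV"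
      unfolding has_integral_restrict_UNIV by (rule integrable_integral[OF *(1)])
  qed (use gm in \<open>auto simp: g_def\<close>)
  finally have "(\<integral>\<^sup>+ \<theta>\<in>{0..2 * pi}. ennreal (g \<theta>) \<partial>lborel) = ennreal (integral {0..2 * pi} g)" .
  with sums that show ?thesis
    by (auto simp: g_def sums_iff)
qed

subsection \<open>Coefficients of the binomial series with negative exponent\<close>

text \<open>Since \<open>g\<close> is positive everywhere, the finitely many exceptional indices can
  be absorbed by adding their ratios \<open>\<bar>f n\<bar> / g n\<close> to the constant. Termwise
  comparison of series needs a bound of this kind.\<close>

lemma bigo_global_bound:
  fixes f g :: "nat \<Rightarrow> real"
  assumes "f \<in> O(g)" and pos: "\<And>n. g n > 0"
  obtains C where "C > 0" and "\<And>n. \<bar>f n\<bar> \<le> C * g n"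
proof -
  obtain c where c: "c > 0" "eventually (\<lambda>n. norm (f n) \<le> c * norm (g n)) sequentially"
    using assms(1) by (rule landau_o.bigE)
  then obtain N where N: "\<And>n. n \<ge> N \<Longrightarrow> \<bar>f n\<bar> \<le> c * g n"
    unfolding eventually_sequentially using pos by (auto simp: less_imp_le)
  define C where "C = c + (\<Sum>n<N. \<bar>f n\<bar> / g n)"
  have nonneg: "0 \<le> (\<Sum>n<N. \<bar>f n\<bar> / g n)"
    using pos by (intro sum_nonneg) (simp add: less_imp_le)
  have "\<bar>f n\<bar> \<le> C * g n" for n
  proof (cases "n < N")
    case True
    have "\<bar>f n\<bar> / g n \<le> (\<Sum>n<N. \<bar>f n\<bar> / g n)"
      using True pos by (intro member_le_sum) (auto simp: less_imp_le)
    also have "\<dots> \<le> C" using c by (simp add: C_def)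
    finally show ?thesis using pos[of n] by (simp add: field_simps)
  next
    case False
    then have "\<bar>f n\<bar> \<le> c * g n" using N by simp
    also have "\<dots> \<le> C * g n"
      using nonneg pos[of n] by (intro mult_right_mono) (auto simp: C_def)
    finally show ?thesis .
  qed
  moreover have "C > 0" using c nonneg by (simp add: C_def)
  ultimately show ?thesis using that by blast
qed

text \<open>The Taylor coefficients of \<open>(1 - q) powr (- \<gamma>)\<close>. The parameter is
  real because the exponent \<open>2 * k - 2 * \<alpha> - 1\<close> occurs besides the natural
  numbers.\<close>

definition negbinom :: "real \<Rightarrow> nat \<Rightarrow> real" where
  "negbinom \<gamma> m = pochhammer \<gamma> m / fact m"

lemma negbinom_0_right [simp]: "negbinom \<gamma> 0 = 1"
  by (simp add: negbinom_def)

lemma negbinom_pos: "\<gamma> > 0 \<Longrightarrow> negbinom \<gamma> m > 0"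
  by (simp add: negbinom_def pochhammer_pos)

lemma negbinom_nonneg: "\<gamma> \<ge> 0 \<Longrightarrow> negbinom \<gamma> m \<ge> 0"
  by (auto simp: negbinom_def pochhammer_prod prod_nonneg)

text \<open>Pascal's rule, which expresses that multiplication by \<open>1 - q\<close> lowers the
  exponent of the generating function by one. It drives both the induction for resolvent powers and
  the summation of coefficients.\<close>

lemma negbinom_Suc_diff: "negbinom (\<gamma> + 1) (Suc m) - negbinom (\<gamma> + 1) m = negbinom \<gamma> (Suc m)"
proof -
  have "pochhammer (\<gamma> + 1) (Suc m) = pochhammer (\<gamma> + 1) m * (\<gamma> + 1 + m)"
    by (rule pochhammer_Suc)
  moreover have "pochhammer \<gamma> (Suc m) = \<gamma> * pochhammer (\<gamma> + 1) m"
    by (rule pochhammer_rec)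
  moreover have "fact (Suc m) = (1 + real m) * fact m"
    by simp
  ultimately show ?thesis
    unfolding negbinom_def by (simp add: divide_simps del: fact_Suc) (simp add: algebra_simps)
qed

lemma sum_negbinom: "(\<Sum>m\<le>N. negbinom \<gamma> m) = negbinom (\<gamma> + 1) N"
  by (induction N) (simp_all add: negbinom_Suc_diff[of \<gamma>, symmetric])

lemma negbinom_gbinomial: "negbinom \<gamma> m = (-1) ^ m * (- \<gamma> gchoose m)"
  by (simp add: negbinom_def gbinomial_pochhammer flip: mult.assoc power_mult_distrib)

text \<open>This is the binomial series with exponent \<open>- \<gamma>\<close> at
  \<open>- q\<close>; the two alternating signs cancel.\<close>

lemma negbinom_series:
  assumes "\<bar>q\<bar> < 1"
  shows "(\<lambda>m. negbinom \<gamma> m * q ^ m) sums (1 - q) powr (- \<gamma>)"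
proof -
  have "(\<lambda>m. (- \<gamma> gchoose m) * (- q) ^ m) sums (1 + - q) powr (- \<gamma>)"
    using assms by (intro gen_binomial_real) simp
  moreover have "(- \<gamma> gchoose m) * (- q) ^ m = negbinom \<gamma> m * q ^ m" for m
    by (simp add: negbinom_gbinomial power_minus[of q])
  ultimately show ?thesis by simp
qed

text \<open>The quotient tends to \<open>inverse (Gamma \<gamma>)\<close>, which is nonzero for
  positive \<open>\<gamma>\<close>; hence the order is exact and usable in both directions.\<close>

lemma negbinom_bigtheta:
  assumes "\<gamma> > 0"
  shows "negbinom \<gamma> \<in> \<Theta>(\<lambda>m. real m powr (\<gamma> - 1))"
proof (rule bigthetaI_tendsto)
  have "(\<lambda>n. (- \<gamma> gchoose n) / ((-1) ^ n / exp ((- \<gamma> + 1) * of_real (ln (real n)))))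
      \<longlonglongrightarrow> inverse (Gamma (- (- \<gamma>)))"
    by (rule gbinomial_asymptotic)
  moreover have "eventually (\<lambda>n. (- \<gamma> gchoose n) / ((-1) ^ n / exp ((- \<gamma> + 1) * of_real (ln (real n))))
      = negbinom \<gamma> n / real n powr (\<gamma> - 1)) sequentially"
    using eventually_gt_at_top[of 0]
  proof eventually_elim
    case (elim n)
    then have "exp ((- \<gamma> + 1) * of_real (ln (real n))) = inverse (real n powr (\<gamma> - 1))"
      by (simp add: powr_def algebra_simps flip: exp_minus)
    then show ?case
      by (cases "even n") (simp_all add: negbinom_gbinomial field_simps)
  qed
  ultimately show "(\<lambda>n. negbinom \<gamma> n / real n powr (\<gamma> - 1)) \<longlonglongrightarrow> inverse (Gamma \<gamma>)"
    by (simp add: tendsto_cong)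
  show "inverse (Gamma \<gamma>) \<noteq> 0"
    using Gamma_real_pos[OF assms] by simp
qed

lemma negbinom_bigo: "\<gamma> > 0 \<Longrightarrow> negbinom \<gamma> \<in> O(\<lambda>m. real m powr (\<gamma> - 1))"
  and powr_bigo_negbinom: "\<gamma> > 0 \<Longrightarrow> (\<lambda>m. real m powr (\<gamma> - 1)) \<in> O(negbinom \<gamma>)"
  using negbinom_bigtheta[of \<gamma>] by (auto simp: bigtheta_def bigomega_iff_bigo)

subsection \<open>Powers of the resolvent\<close>

lemma bounded_linear_funpow:
  fixes T :: "'a::real_normed_vector \<Rightarrow> 'a"
  assumes "bounded_linear T"
  shows "bounded_linear (T ^^ n)"
proof (induction n)
  case (Suc n)
  show ?case
    using bounded_linear_compose[OF assms Suc] by (simp add: o_def)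
qed (simp add: id_def bounded_linear_ident)

lemma power_bounded_norm_bound:
  assumes "bounded_linear T" and "power_bounded T"
  obtains K where "K > 0" and "\<And>n x. norm ((T ^^ n) x) \<le> K * norm x"
proof -
  obtain K where K: "\<And>n. onorm (T ^^ n) \<le> K"
    using assms(2) unfolding power_bounded_def bdd_above_def by auto
  have "norm ((T ^^ n) x) \<le> max K 1 * norm x" for n x
    using onorm[OF bounded_linear_funpow[OF assms(1)], of n x] K[of n]
    by (meson max.coboundedI1 mult_right_mono norm_ge_zero order.trans)
  then show ?thesis by (intro that[of "max K 1"]) auto
qed

text \<open>As \<open>inv\<close> is a left inverse of any injective map, it suffices that
  \<open>z\<close> is no eigenvalue: an eigenvector \<open>w\<close> would satisfy
  \<open>(T ^^ n) w = z ^ n *\<^sub>C w\<close>, whose growth contradicts power-boundedness.\<close>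

lemma resolvent_inverse:
  fixes T :: "'a::complex_normed_vector \<Rightarrow> 'a"
  assumes lin: "bounded_clinear T" and pb: "power_bounded T" and z: "cmod z > 1"
  shows "resolvent z T (z *\<^sub>C x - T x) = x"
proof -
  have bl: "bounded_linear T" and hom: "\<And>c x. T (c *\<^sub>C x) = c *\<^sub>C T x"
    using lin by (auto simp: bounded_clinear_def)
  obtain K where K: "K > 0" "\<And>n x. norm ((T ^^ n) x) \<le> K * norm x"
    using power_bounded_norm_bound[OF bl pb] by blast
  have "inj (\<lambda>x. z *\<^sub>C x - T x)"
  proof (rule injI)
    fix x y
    assume eq: "z *\<^sub>C x - T x = z *\<^sub>C y - T y"
    define w where "w = x - y"
    have Tw: "T w = z *\<^sub>C w"
      using eq by (simp add: w_def linear_diff[OF bounded_linear.linear[OF bl]]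
          linear_diff[OF bounded_linear.linear[OF bounded_linear_scaleC]] algebra_simps)
    have pow: "(T ^^ n) w = z ^ n *\<^sub>C w" for n
      by (induction n) (simp_all add: scaleC_one hom Tw scaleC_scaleC mult.commute)
    have bound: "cmod z ^ n * norm w \<le> K * norm w" for n
      using K(2)[of n w] by (simp add: pow norm_scaleC norm_power)
    obtain n where "K < cmod z ^ n"
      using real_arch_pow[OF z] by blast
    with bound[of n] have "norm w = 0"
      by (metis mult_le_cancel_right not_less norm_ge_zero order.not_eq_order_implies_strict)
    then show "x = y" by (simp add: w_def)
  qed
  then show ?thesis
    unfolding resolvent_def by (rule inv_f_f)
qed

text \<open>By induction on \<open>k\<close>: applying \<open>z I - T\<close> to the series for
  \<open>Suc k\<close> gives the series for \<open>k\<close>, and \<open>resolvent_inverse\<close>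
  undoes this.\<close>

lemma resolvent_power_series:
  fixes T :: "'a::complex_banach \<Rightarrow> 'a"
  assumes lin: "bounded_clinear T" and pb: "power_bounded T" and z: "cmod (z :: complex) > 1"
  shows "summable (\<lambda>m. norm ((complex_of_real (negbinom (real k) m) / z ^ (m + k)) *\<^sub>C (T ^^ m) x))"
    and "(resolvent z T ^^ k) x = (\<Sum>m. (complex_of_real (negbinom (real k) m) / z ^ (m + k)) *\<^sub>C (T ^^ m) x)"
proof -
  have bl: "bounded_linear T" and hom: "\<And>c x. T (c *\<^sub>C x) = c *\<^sub>C T x"
    using lin by (auto simp: bounded_clinear_def)
  obtain K where K: "K > 0" "\<And>n x. norm ((T ^^ n) x) \<le> K * norm x"
    using power_bounded_norm_bound[OF bl pb] by blast
  \<comment> \<open>The index \<open>k\<close> is generalized here so that the induction can pass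
    from \<open>k\<close> to \<open>Suc k\<close>.\<close>
  define a where "a k m = (complex_of_real (negbinom (real k) m) / z ^ (m + k)) *\<^sub>C (T ^^ m) x" for k m
  have sn: "summable (\<lambda>m. norm (a k m))" for k
  proof (rule summable_comparison_test)
    have "\<bar>inverse (cmod z)\<bar> < 1" using z by (simp add: inverse_less_1_iff)
    then have "summable (\<lambda>m. negbinom (real k) m * inverse (cmod z) ^ m)"
      using negbinom_series sums_summable by blast
    then show "summable (\<lambda>m. (K * norm x / cmod z ^ k) * (negbinom (real k) m * inverse (cmod z) ^ m))"
      by (rule summable_mult)
    have "norm (a k m) \<le> (K * norm x / cmod z ^ k) * (negbinom (real k) m * inverse (cmod z) ^ m)" for m
    proof -
      have "norm (a k m) = negbinom (real k) m / cmod z ^ (m + k) * norm ((T ^^ m) x)"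
        by (simp add: a_def norm_scaleC norm_divide norm_power negbinom_nonneg)
      also have "\<dots> \<le> negbinom (real k) m / cmod z ^ (m + k) * (K * norm x)"
        by (intro mult_left_mono K) (simp add: negbinom_nonneg)
      finally show ?thesis by (simp add: power_add field_simps)
    qed
    then show "\<exists>N. \<forall>m\<ge>N. norm (norm (a k m))
      \<le> (K * norm x / cmod z ^ k) * (negbinom (real k) m * inverse (cmod z) ^ m)" by simp
  qed
  then have s: "summable (a k)" for k
    using summable_norm_cancel by blast
  have step: "z *\<^sub>C suminf (a (Suc k)) - T (suminf (a (Suc k))) = suminf (a k)" for k
  proof -
    have z0: "z \<noteq> 0" using z by auto
    have zs: "summable (\<lambda>m. z *\<^sub>C a (Suc k) m)" and Ts: "summable (\<lambda>m. T (a (Suc k) m))"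
      using bounded_linear.summable[OF bounded_linear_scaleC s] bounded_linear.summable[OF bl s] by auto
    have first: "z *\<^sub>C a (Suc k) 0 = a k 0"
      using z0 by (simp add: a_def scaleC_scaleC)
    \<comment> \<open>\<open>T\<close> raises the power of \<open>T\<close> by one, so term
      \<open>m\<close> of the second series meets term \<open>Suc m\<close> of the first, and
      Pascal's rule combines them.\<close>
    have rest: "z *\<^sub>C a (Suc k) (Suc m) - T (a (Suc k) m) = a k (Suc m)" for m
    proof -
      have "z *\<^sub>C a (Suc k) (Suc m) - T (a (Suc k) m)
        = (z * (complex_of_real (negbinom (real (Suc k)) (Suc m)) / z ^ (Suc m + Suc k))
            - complex_of_real (negbinom (real (Suc k)) m) / z ^ (m + Suc k)) *\<^sub>C (T ^^ Suc m) x"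
        by (simp add: a_def hom scaleC_scaleC scaleC_diff_left)
      also have "z * (complex_of_real (negbinom (real (Suc k)) (Suc m)) / z ^ (Suc m + Suc k))
            - complex_of_real (negbinom (real (Suc k)) m) / z ^ (m + Suc k)
        = complex_of_real (negbinom (real k + 1) (Suc m) - negbinom (real k + 1) m) / z ^ (Suc m + k)"
        using z0 by (simp add: diff_divide_distrib add.commute)
      finally show ?thesis
        unfolding negbinom_Suc_diff a_def .
    qed
    have "z *\<^sub>C suminf (a (Suc k)) - T (suminf (a (Suc k)))
      = (\<Sum>m. z *\<^sub>C a (Suc k) m) - (\<Sum>m. T (a (Suc k) m))"
      by (simp add: bounded_linear.suminf[OF bounded_linear_scaleC s] bounded_linear.suminf[OF bl s])
    also have "\<dots> = a k 0 + (\<Sum>m. z *\<^sub>C a (Suc k) (Suc m)) - (\<Sum>m. T (a (Suc k) m))"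
      using suminf_split_head[OF zs] first by simp
    also have "\<dots> = a k 0 + (\<Sum>m. z *\<^sub>C a (Suc k) (Suc m) - T (a (Suc k) m))"
      using zs Ts by (subst suminf_diff[symmetric]) (simp_all add: summable_Suc_iff[of "\<lambda>m. z *\<^sub>C a (Suc k) m"])
    also have "\<dots> = suminf (a k)"
      using suminf_split_head[OF s, of k] by (simp add: rest)
    finally show ?thesis .
  qed
  have "(resolvent z T ^^ k) x = suminf (a k)"
  proof (induction k)
    case 0
    \<comment> \<open>\<open>pochhammer 0 m\<close> vanishes for \<open>m > 0\<close>, so only the
      term \<open>x\<close> is left.\<close>
    have "a 0 m = (if m = 0 then x else 0)" for m
      by (cases m) (simp_all add: a_def negbinom_def scaleC_one scaleC_zero_left pochhammer_0_left)
    then have "suminf (a 0) = x" using suminf_finite[of "{0}" "a 0"] by simp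
    then show ?case by simp
  next
    case (Suc k)
    then show ?case
      using resolvent_inverse[OF lin pb z, of "suminf (a (Suc k))"] by (simp add: step)
  qed
  with sn show "summable (\<lambda>m. norm ((complex_of_real (negbinom (real k) m) / z ^ (m + k)) *\<^sub>C (T ^^ m) x))"
    and "(resolvent z T ^^ k) x = (\<Sum>m. (complex_of_real (negbinom (real k) m) / z ^ (m + k)) *\<^sub>C (T ^^ m) x)"
    by (simp_all add: a_def[abs_def])
qed

text \<open>On the circle of radius \<open>r\<close>, the factor \<open>1 / z ^ (m + k)\<close>
  splits into a modulus, the phase \<open>cis (- (m * \<theta>))\<close> and the common phase
  \<open>cis (- (k * \<theta>))\<close>. The common phase does not affect the norm, and Parseval
  applies to the rest.\<close>

lemma nn_integral_resolvent_power:
  fixes T :: "'a::complex_hilbert \<Rightarrow> 'a"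
  assumes lin: "bounded_clinear T" and pb: "power_bounded T" and r: "r > 1"
  shows "summable (\<lambda>m. (negbinom (real k) m / r ^ (m + k) * norm ((T ^^ m) x))\<^sup>2)"
    and "(\<integral>\<^sup>+ \<theta>\<in>{0..2 * pi}.
        ennreal ((norm ((resolvent (complex_of_real r * exp (\<i> * complex_of_real \<theta>)) T ^^ k) x))\<^sup>2)
        \<partial>lborel)
      = ennreal (2 * pi * (\<Sum>m. (negbinom (real k) m / r ^ (m + k) * norm ((T ^^ m) x))\<^sup>2))"
proof -
  define v where "v m = (complex_of_real (negbinom (real k) m / r ^ (m + k))) *\<^sub>C (T ^^ m) x" for m
  have norm_v: "norm (v m) = negbinom (real k) m / r ^ (m + k) * norm ((T ^^ m) x)" for m
    unfolding v_def norm_scaleC norm_of_real using r by (simp add: negbinom_nonneg)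
  have sv: "summable (\<lambda>m. norm (v m))"
    using resolvent_power_series(1)[OF lin pb, where z = "complex_of_real r" and k = k and x = x] r by (simp add: v_def)
  have rot: "norm ((resolvent (complex_of_real r * exp (\<i> * complex_of_real \<theta>)) T ^^ k) x)
    = norm (\<Sum>m. cis (- (real m * \<theta>)) *\<^sub>C v m)" for \<theta>
  proof -
    define z where "z = complex_of_real r * exp (\<i> * complex_of_real \<theta>)"
    have z: "z = complex_of_real r * cis \<theta>" "cmod z > 1"
      using r by (simp_all add: z_def cis_conv_exp norm_mult)
    have "(complex_of_real (negbinom (real k) m) / z ^ (m + k)) *\<^sub>C (T ^^ m) x
        = cis (- (real k * \<theta>)) *\<^sub>C cis (- (real m * \<theta>)) *\<^sub>C v m" for m
    proof -
      have "real (m + k) * \<theta> + (- (real k * \<theta>) + - (real m * \<theta>)) = 0"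
        by (simp add: algebra_simps)
      then have "cis \<theta> ^ (m + k) * (cis (- (real k * \<theta>)) * cis (- (real m * \<theta>))) = 1"
        by (simp only: Complex.DeMoivre cis_mult cis_zero)
      then have "inverse (cis \<theta> ^ (m + k)) = cis (- (real k * \<theta>)) * cis (- (real m * \<theta>))"
        by (rule inverse_unique)
      then show ?thesis
        unfolding v_def scaleC_scaleC z(1) power_mult_distrib
        by (simp add: divide_inverse mult_ac)
    qed
    then have "(resolvent z T ^^ k) x = (\<Sum>m. cis (- (real k * \<theta>)) *\<^sub>C cis (- (real m * \<theta>)) *\<^sub>C v m)"
      using resolvent_power_series(2)[OF lin pb z(2), of k x] by simp
    also have "\<dots> = cis (- (real k * \<theta>)) *\<^sub>C (\<Sum>m. cis (- (real m * \<theta>)) *\<^sub>C v m)"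
      by (rule bounded_linear.suminf[OF bounded_linear_scaleC, symmetric], rule summable_norm_cancel)
         (use sv in \<open>simp add: norm_scaleC\<close>)
    finally show ?thesis by (simp add: norm_scaleC z_def)
  qed
  obtain "summable (\<lambda>m. (norm (v m))\<^sup>2)"
    and "(\<integral>\<^sup>+ \<theta>\<in>{0..2 * pi}. ennreal ((norm (\<Sum>m. cis (- (real m * \<theta>)) *\<^sub>C v m))\<^sup>2) \<partial>lborel)
      = ennreal (2 * pi * (\<Sum>m. (norm (v m))\<^sup>2))"
    using parseval_nn_integral[OF sv] by blast
  then show "summable (\<lambda>m. (negbinom (real k) m / r ^ (m + k) * norm ((T ^^ m) x))\<^sup>2)"
    and "(\<integral>\<^sup>+ \<theta>\<in>{0..2 * pi}.
        ennreal ((norm ((resolvent (complex_of_real r * exp (\<i> * complex_of_real \<theta>)) T ^^ k) x))\<^sup>2)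
        \<partial>lborel)
      = ennreal (2 * pi * (\<Sum>m. (negbinom (real k) m / r ^ (m + k) * norm ((T ^^ m) x))\<^sup>2))"
    by (simp_all add: rot norm_v)
qed

subsection \<open>Decay of orbits and weighted series\<close>

lemma weighted_series_bound_if_decay:
  fixes T :: "'x::complex_normed_vector \<Rightarrow> 'x" and S :: "'y::complex_normed_vector \<Rightarrow> 'x"
  assumes "bounded_linear T" and "bounded_linear S"
    and k: "real k > \<alpha> + 1 / 2" "k \<ge> 1"
    and decay: "(\<lambda>n. onorm ((T ^^ n) \<circ> S)) \<in> O(\<lambda>n. real n powr (- \<alpha>))"
  obtains C where "C > 0"
    and "\<And>r y. r \<in> {1<..<2} \<Longrightarrow> (r - 1) powr (2 * real k - 2 * \<alpha> - 1) *
      (\<Sum>m. (negbinom (real k) m / r ^ (m + k) * norm ((T ^^ m) (S y)))\<^sup>2) \<le> C * (norm y)\<^sup>2"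
proof -
  define \<gamma> where "\<gamma> = 2 * real k - 2 * \<alpha> - 1"
  define u where "u m = onorm ((T ^^ m) \<circ> S)" for m
  have \<gamma>: "\<gamma> > 0" using k by (simp add: \<gamma>_def)
  have blS: "bounded_linear ((T ^^ m) \<circ> S)" for m
    unfolding o_def by (intro bounded_linear_compose[OF bounded_linear_funpow] assms)
  have "negbinom (real k) \<in> O(\<lambda>m. real m powr (real k - 1))"
    using k by (intro negbinom_bigo) simp
  then have "(\<lambda>m. (negbinom (real k) m * u m)\<^sup>2) \<in> O(\<lambda>m. (real m powr (real k - 1) * real m powr (- \<alpha>))\<^sup>2)"
    using decay unfolding u_def by (intro landau_o.big_power landau_o.big.mult)
  also have "(\<lambda>m. (real m powr (real k - 1) * real m powr (- \<alpha>))\<^sup>2) = (\<lambda>m. real m powr (\<gamma> - 1))"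
    by (simp add: power2_eq_square \<gamma>_def algebra_simps flip: powr_add)
  also have "(\<lambda>m. real m powr (\<gamma> - 1)) \<in> O(negbinom \<gamma>)"
    using \<gamma> by (rule powr_bigo_negbinom)
  \<comment> \<open>The bound for all \<open>m\<close> is taken against
    \<open>negbinom \<gamma>\<close>, since \<open>real m powr (\<gamma> - 1)\<close> is zero at
    \<open>m = 0\<close>.\<close>
  finally obtain C where C: "C > 0" "\<And>m. (negbinom (real k) m * u m)\<^sup>2 \<le> C * negbinom \<gamma> m"
    by (rule bigo_global_bound) (use negbinom_pos[OF \<gamma>] in auto)
  have "(r - 1) powr \<gamma> * (\<Sum>m. (negbinom (real k) m / r ^ (m + k) * norm ((T ^^ m) (S y)))\<^sup>2)
      \<le> (2 powr \<gamma> * C) * (norm y)\<^sup>2" if r: "r \<in> {1<..<2}" for r y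
  proof -
    define q where "q = inverse r"
    have q: "0 < q" "q < 1" using r by (auto simp: q_def inverse_less_1_iff)
    have bound: "(negbinom (real k) m / r ^ (m + k) * norm ((T ^^ m) (S y)))\<^sup>2
      \<le> (C * (norm y)\<^sup>2) * (negbinom \<gamma> m * q ^ m)" for m
    proof -
      have "norm ((T ^^ m) (S y)) \<le> u m * norm y"
        using onorm[OF blS[of m], of y] by (simp add: u_def)
      then have "(negbinom (real k) m * q ^ (m + k) * norm ((T ^^ m) (S y)))\<^sup>2
          \<le> (negbinom (real k) m * q ^ (m + k) * (u m * norm y))\<^sup>2"
        using q by (intro power_mono mult_left_mono) (auto simp: negbinom_nonneg)
      also have "\<dots> = (negbinom (real k) m * u m)\<^sup>2 * (norm y)\<^sup>2 * q ^ (2 * (m + k))"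
        by (simp add: power_mult_distrib mult_ac flip: power_mult)
      \<comment> \<open>Surplus powers of \<open>q < 1\<close> are dropped; the series in
        \<open>q\<close> still has a singularity of order \<open>\<gamma>\<close> at 1.\<close>
      also have "\<dots> \<le> (C * negbinom \<gamma> m) * (norm y)\<^sup>2 * q ^ m"
        using q C negbinom_pos[OF \<gamma>, of m]
        by (intro mult_mono mult_right_mono power_decreasing) auto
      finally show ?thesis by (simp add: q_def divide_inverse power_inverse mult_ac)
    qed
    have geo: "(\<lambda>m. (C * (norm y)\<^sup>2) * (negbinom \<gamma> m * q ^ m)) sums ((C * (norm y)\<^sup>2) * (1 - q) powr (- \<gamma>))"
      using q by (intro sums_mult negbinom_series) simp
    have "summable (\<lambda>m. (negbinom (real k) m / r ^ (m + k) * norm ((T ^^ m) (S y)))\<^sup>2)"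
      by (rule summable_comparison_test'[OF sums_summable[OF geo], of 0]) (use bound in simp)
    then have "(\<Sum>m. (negbinom (real k) m / r ^ (m + k) * norm ((T ^^ m) (S y)))\<^sup>2)
        \<le> (\<Sum>m. (C * (norm y)\<^sup>2) * (negbinom \<gamma> m * q ^ m))"
      using geo by (intro suminf_le bound) (auto simp: sums_iff)
    also have "\<dots> = (C * (norm y)\<^sup>2) * (1 - q) powr (- \<gamma>)"
      using geo by (simp add: sums_iff)
    finally have "(r - 1) powr \<gamma> * (\<Sum>m. (negbinom (real k) m / r ^ (m + k) * norm ((T ^^ m) (S y)))\<^sup>2)
      \<le> (r - 1) powr \<gamma> * ((C * (norm y)\<^sup>2) * (1 - q) powr (- \<gamma>))"
      by (intro mult_left_mono) auto
    also have "\<dots> = r powr \<gamma> * (C * (norm y)\<^sup>2)"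
    proof -
      \<comment> \<open>Since \<open>r - 1 = r * (1 - q)\<close>, the weight cancels the singularity
        and leaves \<open>r powr \<gamma>\<close>, which is below
        \<open>2 powr \<gamma>\<close>.\<close>
      have "(r - 1) powr \<gamma> = r powr \<gamma> * (1 - q) powr \<gamma>"
        using r q by (simp add: q_def algebra_simps flip: powr_mult)
      then show ?thesis
        using q by (simp add: powr_minus)
    qed
    also have "\<dots> \<le> 2 powr \<gamma> * (C * (norm y)\<^sup>2)"
      using r \<gamma> C by (intro mult_right_mono powr_mono2) auto
    finally show ?thesis by (simp only: mult.assoc)
  qed
  with C show ?thesis
    by (intro that[of "2 powr \<gamma> * C"]) (simp_all add: \<gamma>_def)
qed

lemma decay_if_weighted_series_bound:
  fixes T :: "'x::complex_normed_vector \<Rightarrow> 'x" and S :: "'y::complex_normed_vector \<Rightarrow> 'x"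
  assumes blT: "bounded_linear T" and blS: "bounded_linear S" and pb: "power_bounded T" and k: "k \<ge> 1" and M: "M \<ge> 0"
    and summable: "\<And>r y. r \<in> {1<..<2} \<Longrightarrow>
      summable (\<lambda>m. (negbinom (real k) m / r ^ (m + k) * norm ((T ^^ m) (S y)))\<^sup>2)"
    and bound: "\<And>r y. r \<in> {1<..<2} \<Longrightarrow> (r - 1) powr (2 * real k - 2 * \<alpha> - 1) *
      (\<Sum>m. (negbinom (real k) m / r ^ (m + k) * norm ((T ^^ m) (S y)))\<^sup>2) \<le> M * (norm y)\<^sup>2"
  shows "(\<lambda>n. onorm ((T ^^ n) \<circ> S)) \<in> O(\<lambda>n. real n powr (- \<alpha>))"
proof -
  obtain K where K: "K > 0" "\<And>n x. norm ((T ^^ n) x) \<le> K * norm x"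
    using power_bounded_norm_bound[OF blT pb] by blast
  define \<gamma> where "\<gamma> = 2 * real k - 2 * \<alpha> - 1"
  \<comment> \<open>Bounds \<open>(r ^ (m + k)) ^ 2\<close> for \<open>m \<le> N\<close> and
    \<open>r = 1 + 1 / N\<close>: the factor \<open>exp 2\<close> comes from
    \<open>r ^ (2 * N)\<close>, the factor \<open>4 ^ k\<close> from \<open>r < 2\<close>.\<close>
  define E where "E = exp (2::real) * 4 ^ k"
  have E: "E > 0" by (simp add: E_def)
  \<comment> \<open>The squared coefficients are compared with \<open>negbinom (2 * k - 1)\<close>,
    which has the same order \<open>2 * k - 2\<close> and whose partial sums are given exactly by
    \<open>sum_negbinom\<close>.\<close>
  have "(\<lambda>m. real m powr (2 * real k - 1 - 1)) \<in> O(\<lambda>m. (negbinom (real k) m)\<^sup>2)"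
  proof -
    have "(\<lambda>m. real m powr (real k - 1)) \<in> O(negbinom (real k))"
      using k by (intro powr_bigo_negbinom) simp
    then have "(\<lambda>m. (real m powr (real k - 1))\<^sup>2) \<in> O(\<lambda>m. (negbinom (real k) m)\<^sup>2)"
      by (rule landau_o.big_power)
    then show ?thesis
      by (simp add: power2_eq_square flip: powr_add)
  qed
  with negbinom_bigo[of "2 * real k - 1"] k
  have "negbinom (2 * real k - 1) \<in> O(\<lambda>m. (negbinom (real k) m)\<^sup>2)"
    by (auto intro: landau_o.big_trans)
  then obtain C where C: "C > 0" "\<And>m. \<bar>negbinom (2 * real k - 1) m\<bar> \<le> C * (negbinom (real k) m)\<^sup>2"
    by (rule bigo_global_bound) (use negbinom_pos[of "real k"] k in \<open>auto simp: less_imp_neq[symmetric]\<close>)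
  obtain D where D: "D > 0" "\<And>m. \<bar>real m powr (2 * real k - 1)\<bar> \<le> D * negbinom (2 * real k) m"
    using powr_bigo_negbinom[of "2 * real k"] k negbinom_pos[of "2 * real k"]
    by (auto elim: bigo_global_bound)
  define A where "A = D * C * E * K\<^sup>2 * M"
  have A: "A \<ge> 0" using C D E K M by (simp add: A_def)
  \<comment> \<open>\<open>N \<ge> 2\<close> places \<open>1 + 1 / N\<close> strictly below
    2.\<close>
  have main: "onorm ((T ^^ N) \<circ> S) \<le> sqrt A * real N powr (- \<alpha>)" if N: "N \<ge> 2" for N
  proof (rule onorm_bound)
    fix y
    \<comment> \<open>With this radius the weight is \<open>real N powr (- \<gamma>)\<close>, while
      the powers \<open>r ^ m\<close> with \<open>m \<le> N\<close> stay bounded.\<close>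
    define r where "r = 1 + 1 / real N"
    define t where "t = norm ((T ^^ N) (S y))"
    have r: "r \<in> {1<..<2}" using N by (simp add: r_def)
    have rE: "(r ^ (m + k))\<^sup>2 \<le> E" if "m \<le> N" for m
    proof -
      have "r ^ N \<le> exp 1"
        unfolding r_def using N exp_ge_one_plus_x_over_n_power_n[of N 1] by simp
      then have "(r ^ N)\<^sup>2 \<le> (exp 1)\<^sup>2"
        using r by (intro power_mono) auto
      moreover have "(r ^ m)\<^sup>2 \<le> (r ^ N)\<^sup>2"
        using r that by (intro power_mono power_increasing) auto
      moreover have "(r ^ k)\<^sup>2 \<le> (2 ^ k)\<^sup>2"
        using r by (intro power_mono) auto
      ultimately have "(r ^ m)\<^sup>2 * (r ^ k)\<^sup>2 \<le> (exp 1)\<^sup>2 * (2 ^ k)\<^sup>2"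
        by (intro mult_mono) auto
      also have "\<dots> = E"
        by (simp add: E_def power2_eq_square flip: exp_add power_mult_distrib)
      finally show ?thesis by (simp add: power_add power_mult_distrib)
    qed
    \<comment> \<open>Three costs are paid: \<open>C\<close> for exchanging the coefficients,
      \<open>K ^ 2\<close> for passing from \<open>T ^^ m\<close> to \<open>T ^^ N\<close>, and
      \<open>E\<close> for inserting the powers of \<open>r\<close>.\<close>
    have term_le: "negbinom (2 * real k - 1) m * t\<^sup>2
        \<le> (C * E * K\<^sup>2) * (negbinom (real k) m / r ^ (m + k) * norm ((T ^^ m) (S y)))\<^sup>2" if "m \<le> N" for m
    proof -
      have "t = norm ((T ^^ (N - m)) ((T ^^ m) (S y)))"
        using that by (simp add: t_def flip: funpow_add comp_apply[of "T ^^ (N - m)"])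
      then have t: "t\<^sup>2 \<le> (K * norm ((T ^^ m) (S y)))\<^sup>2"
        using K(2)[of "N - m" "(T ^^ m) (S y)"] by (intro power_mono) (auto simp: t_def)
      have "negbinom (2 * real k - 1) m * t\<^sup>2
          \<le> (C * (negbinom (real k) m)\<^sup>2) * (K * norm ((T ^^ m) (S y)))\<^sup>2"
        using C(2)[of m] t C(1) by (intro mult_mono) auto
      also have "\<dots> = (C * (negbinom (real k) m)\<^sup>2) * (K * norm ((T ^^ m) (S y)))\<^sup>2 * 1"
        by simp
      also have "\<dots> \<le> (C * (negbinom (real k) m)\<^sup>2) * (K * norm ((T ^^ m) (S y)))\<^sup>2 * (E / (r ^ (m + k))\<^sup>2)"
        using C(1) r rE[OF that] by (intro mult_left_mono) auto
      finally show ?thesis by (simp add: power_mult_distrib power_divide mult_ac)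
    qed
    have "real N powr (2 * real k - 1) * t\<^sup>2 \<le> D * negbinom (2 * real k) N * t\<^sup>2"
      using D(2)[of N] by (intro mult_right_mono) auto
    also have "\<dots> = D * (\<Sum>m\<le>N. negbinom (2 * real k - 1) m * t\<^sup>2)"
      using sum_negbinom[of "2 * real k - 1" N] by (simp flip: sum_distrib_right)
    also have "\<dots> \<le> D * (\<Sum>m\<le>N. (C * E * K\<^sup>2) * (negbinom (real k) m / r ^ (m + k) * norm ((T ^^ m) (S y)))\<^sup>2)"
      using D(1) term_le by (intro mult_left_mono sum_mono) auto
    also have "\<dots> = (D * C * E * K\<^sup>2) * (\<Sum>m\<le>N. (negbinom (real k) m / r ^ (m + k) * norm ((T ^^ m) (S y)))\<^sup>2)"
      by (simp add: mult.assoc flip: sum_distrib_left)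
    also have "\<dots> \<le> (D * C * E * K\<^sup>2) * (\<Sum>m. (negbinom (real k) m / r ^ (m + k) * norm ((T ^^ m) (S y)))\<^sup>2)"
      using D C E by (intro mult_left_mono sum_le_suminf summable r) auto
    also have "\<dots> = (D * C * E * K\<^sup>2) * (real N powr \<gamma> * ((r - 1) powr \<gamma> *
        (\<Sum>m. (negbinom (real k) m / r ^ (m + k) * norm ((T ^^ m) (S y)))\<^sup>2)))"
      using N by (simp add: r_def powr_divide)
    also have "\<dots> \<le> (D * C * E * K\<^sup>2) * (real N powr \<gamma> * (M * (norm y)\<^sup>2))"
      using D C E bound[OF r, of y] by (intro mult_left_mono) (auto simp: \<gamma>_def)
    also have "\<dots> = real N powr (2 * real k - 1) * (A * (real N powr (- \<alpha>))\<^sup>2 * (norm y)\<^sup>2)"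
    proof -
      \<comment> \<open>\<open>\<gamma>\<close> equals \<open>(2 * k - 1) - 2 * \<alpha>\<close>, so
        cancelling \<open>real N powr (2 * k - 1)\<close> leaves the square of the desired
        rate.\<close>
      have "real N powr \<gamma> = real N powr (2 * real k - 1) * (real N powr (- \<alpha>))\<^sup>2"
        by (simp add: \<gamma>_def power2_eq_square algebra_simps flip: powr_add)
      then show ?thesis by (simp add: A_def)
    qed
    finally have "t\<^sup>2 \<le> A * (real N powr (- \<alpha>))\<^sup>2 * (norm y)\<^sup>2"
      using N by simp
    also have "\<dots> = (sqrt A * real N powr (- \<alpha>) * norm y)\<^sup>2"
      using A by (simp add: power_mult_distrib)
    finally have "t \<le> sqrt A * real N powr (- \<alpha>) * norm y"
      by (rule power2_le_imp_le) (use A in simp)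
    then show "norm (((T ^^ N) \<circ> S) y) \<le> sqrt A * real N powr (- \<alpha>) * norm y"
      by (simp add: t_def)
  qed (use A in simp)
  have "onorm ((T ^^ N) \<circ> S) \<ge> 0" for N
    unfolding o_def by (intro onorm_pos_le bounded_linear_compose[OF bounded_linear_funpow] blT blS)
  with main have "norm (onorm ((T ^^ N) \<circ> S)) \<le> sqrt A * norm (real N powr (- \<alpha>))" if "N \<ge> 2" for N
    using that by simp
  then show ?thesis
    by (intro bigoI[of _ "sqrt A"]) (auto simp: eventually_sequentially)
qed

section \<open>Equivalence of the decay rate and the resolvent integral bound\<close>

theorem theorem1p2:
  fixes T :: "'x::complex_hilbert \<Rightarrow> 'x"
    and S :: "'y::complex_banach \<Rightarrow> 'x"
    and \<alpha> :: real and k :: nat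
  assumes "bounded_clinear T" and "power_bounded T"
    and "bounded_clinear S"
    and "\<alpha> > 0" and "k \<ge> 1" and "real k > \<alpha> + 1 / 2"
  shows "(\<lambda>n. onorm ((T ^^ n) \<circ> S)) \<in> O(\<lambda>n. real n powr (- \<alpha>)) \<longleftrightarrow>
    (\<exists>M>0. \<forall>y.
      (SUP r\<in>{1<..<2}. ennreal ((r - 1) powr (2 * real k - 2 * \<alpha> - 1)) *
        (\<integral>\<^sup>+ \<theta>\<in>{0..2 * pi}.
          ennreal ((norm ((resolvent (complex_of_real r * exp (\<i> * complex_of_real \<theta>)) T ^^ k) (S y)))\<^sup>2)
          \<partial>lborel))
      \<le> ennreal (M * (norm y)\<^sup>2))"
    (is "?decay \<longleftrightarrow> (\<exists>M>0. \<forall>y. (SUP r\<in>_. ?I r y) \<le> _)")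
proof -
  have blT: "bounded_linear T" and blS: "bounded_linear S"
    using assms by (auto simp: bounded_clinear_def)
  \<comment> \<open>The real-valued weighted series; Parseval identifies the weighted integral with
    \<open>2 * pi * \<Phi> r y\<close>.\<close>
  define \<Phi> where "\<Phi> r y = (r - 1) powr (2 * real k - 2 * \<alpha> - 1) *
      (\<Sum>m. (negbinom (real k) m / r ^ (m + k) * norm ((T ^^ m) (S y)))\<^sup>2)" for r y
  note series = nn_integral_resolvent_power[OF assms(1,2), where k = k]
  have I: "?I r y = ennreal (2 * pi * \<Phi> r y)" if "r \<in> {1<..<2}" for r y
  proof -
    have "?I r y = ennreal ((r - 1) powr (2 * real k - 2 * \<alpha> - 1)) *
        ennreal (2 * pi * (\<Sum>m. (negbinom (real k) m / r ^ (m + k) * norm ((T ^^ m) (S y)))\<^sup>2))"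
      using series(2)[of r "S y"] that by simp
    also have "\<dots> = ennreal (2 * pi * \<Phi> r y)"
      by (subst ennreal_mult'[symmetric]) (simp_all add: \<Phi>_def mult_ac)
    finally show ?thesis .
  qed
  \<comment> \<open>Nonnegativity of the right-hand side allows \<open>ennreal\<close> to be
    removed, so both directions become real inequalities for each \<open>r\<close>.\<close>
  have sup: "(SUP r\<in>{1<..<2}. ?I r y) \<le> ennreal (M * (norm y)\<^sup>2) \<longleftrightarrow>
      (\<forall>r\<in>{1<..<2}. 2 * pi * \<Phi> r y \<le> M * (norm y)\<^sup>2)" if "M > 0" for M y
    unfolding SUP_le_iff using that by (intro ball_cong refl) (simp only: I, simp)
  show ?thesis
  proof
    assume ?decay
    then obtain C where C: "C > 0" "\<And>r y. r \<in> {1<..<2} \<Longrightarrow> \<Phi> r y \<le> C * (norm y)\<^sup>2"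
      using weighted_series_bound_if_decay[OF blT blS assms(6,5)] unfolding \<Phi>_def by blast
    then have "2 * pi * C > 0" by simp
    with C show "\<exists>M>0. \<forall>y. (SUP r\<in>{1<..<2}. ?I r y) \<le> ennreal (M * (norm y)\<^sup>2)"
      by (intro exI[of _ "2 * pi * C"] conjI allI iffD2[OF sup] ballI) (simp_all add: mult.assoc)
  next
    assume "\<exists>M>0. \<forall>y. (SUP r\<in>{1<..<2}. ?I r y) \<le> ennreal (M * (norm y)\<^sup>2)"
    then obtain M where M: "M > 0" "\<And>r y. r \<in> {1<..<2} \<Longrightarrow> 2 * pi * \<Phi> r y \<le> M * (norm y)\<^sup>2"
      by (auto simp: sup)
    show ?decay
    proof (rule decay_if_weighted_series_bound[OF blT blS assms(2,5)])
      \<comment> \<open>The factor \<open>2 * pi\<close> from Parseval is moved into the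
        constant.\<close>
      show "M / (2 * pi) \<ge> 0" using M by simp
      show "summable (\<lambda>m. (negbinom (real k) m / r ^ (m + k) * norm ((T ^^ m) (S y)))\<^sup>2)"
        if "r \<in> {1<..<2}" for r y
        using series(1)[of r "S y"] that by simp
      show "(r - 1) powr (2 * real k - 2 * \<alpha> - 1) *
          (\<Sum>m. (negbinom (real k) m / r ^ (m + k) * norm ((T ^^ m) (S y)))\<^sup>2)
          \<le> M / (2 * pi) * (norm y)\<^sup>2" if "r \<in> {1<..<2}" for r y
        using M(2)[OF that, of y] unfolding \<Phi>_def by (simp add: field_simps)
    qed
  qed
qed

end
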